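(* For all integers $n\geq 2$, we have $$|S_n^{(2)}(132:213)|=2n-2.$$
   Context: $S_n$ denotes the set of permutations $p=p(1)p(2)\cdots p(n)$ of $\{1,2,\ldots,n\}$ in one-line notation. For $p\in S_n$ and $q\in S_m$, $p$ contains $q$ as a pattern if there exist $1\leq i_1<\cdots<i_m\leq n$ such that for all $1\leq a<b\leq m$, $p(i_a)<p(i_b)$ if and only if $q(a)<q(b)$; otherwise $p$ avoids $q$. For $p\in S_n$ with $n\geq 2$, $p^{(2)}=p(2)p(3)\cdots p(n)p(1)$. For $q_1,q_2\in S_3$, $S_n^{(2)}(q_1:q_2)$ is the set of $p\in S_n$ such that $p$ avoids $q_1$ and $p^{(2)}$ avoids $q_2$. *)

theory Defs
  imports "HOL-Combinatorics.Multiset_Permutations"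
begin

text \<open>
  Permutations are lists in one-line notation: the permutations of \<open>{1..n}\<close> are the elements of
  \<^term>\<open>permutations_of_set {1..n}\<close>, and \<open>p(i)\<close> is \<open>p ! (i - 1)\<close>, as list positions start at 0.
\<close>

definition contains_pattern :: "nat list \<Rightarrow> nat list \<Rightarrow> bool" where
  "contains_pattern p q \<longleftrightarrow>
     (\<exists>i :: nat \<Rightarrow> nat.
        strict_mono_on {..<length q} i \<and> i ` {..<length q} \<subseteq> {..<length p} \<and>
        (\<forall>a b. a < b \<and> b < length q \<longrightarrow> (p ! i a < p ! i b \<longleftrightarrow> q ! a < q ! b)))"

definition avoids_pattern :: "nat list \<Rightarrow> nat list \<Rightarrow> bool" where
  "avoids_pattern p q \<longleftrightarrow> \<not> contains_pattern p q"

text \<open>\<open>S_n\<^sup>(\<^sup>2\<^sup>)(q1 : q2)\<close>; the permutation \<open>p\<^sup>(\<^sup>2\<^sup>) = p(2) \<dots> p(n) p(1)\<close> is \<^term>\<open>rotate1 p\<close>.\<close>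

definition second_shift_avoiders :: "nat \<Rightarrow> nat list \<Rightarrow> nat list \<Rightarrow> nat list set" where
  "second_shift_avoiders n q1 q2 =
     {p \<in> permutations_of_set {1..n}. avoids_pattern p q1 \<and> avoids_pattern (rotate1 p) q2}"

end

theory Submission
  imports Defs
begin

text \<open>
  Write \<open>p = k # q\<close>. Avoiding 132 with \<open>k\<close> as its first letter makes the entries of \<open>q\<close> above \<open>k\<close>
  increase; avoiding 213 with \<open>k\<close> as its last letter makes the entries below \<open>k\<close> increase.
  Given this, a 132 in \<open>q\<close> is a small--big--small subsequence and a 213 is a big--small--big
  one. So both patterns are avoided iff one of the two increasing runs precedes the other entirely.
  This leaves two permutations for each \<open>1 < k < n\<close>, and one for each of \<open>k = 1\<close> and \<open>k = n\<close>.
\<close>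

text \<open>An index function enters the definition only through its values at 0, 1 and 2, and any
  three numbers arise as such values (look them up in a list of length 3). So the quantifier over
  functions becomes one over triples of positions, which can be instantiated directly.\<close>

lemma avoids_pattern_length_3:
  "avoids_pattern p [x, y, z] \<longleftrightarrow>
     (\<forall>i j l. i < j \<and> j < l \<and> l < length p \<longrightarrow>
        \<not> ((p ! i < p ! j \<longleftrightarrow> x < y) \<and> (p ! i < p ! l \<longleftrightarrow> x < z) \<and> (p ! j < p ! l \<longleftrightarrow> y < z)))"
proof -
  have below_3: "{..<3} = {0, 1, 2 :: nat}"
    by auto
  have pairs: "(\<forall>a b. a < b \<and> b < (3::nat) \<longrightarrow> P a b) \<longleftrightarrow> P 0 1 \<and> P 0 2 \<and> P 1 2" for P
  proof -
    have "a < b \<and> b < 3 \<longleftrightarrow> (a, b) \<in> {(0, 1), (0, 2), (1, 2)}" for a b :: nat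
      by auto
    then show ?thesis
      by auto
  qed
  have contains: "contains_pattern p [x, y, z] \<longleftrightarrow>
    (\<exists>i :: nat \<Rightarrow> nat. i 0 < i 1 \<and> i 1 < i 2 \<and> i 2 < length p \<and>
      (p ! i 0 < p ! i 1 \<longleftrightarrow> x < y) \<and> (p ! i 0 < p ! i 2 \<longleftrightarrow> x < z) \<and> (p ! i 1 < p ! i 2 \<longleftrightarrow> y < z))"
    unfolding contains_pattern_def
    by (simp add: pairs numeral_3_eq_3[symmetric])
       (rule ex_cong1, auto simp: below_3 strict_mono_on_def)
  have "\<exists>f :: nat \<Rightarrow> nat. f 0 = i \<and> f 1 = j \<and> f 2 = l" for i j l :: nat
    by (rule exI[of _ "\<lambda>a. [i, j, l] ! a"]) simp
  then have triple: "(\<exists>i :: nat \<Rightarrow> nat. P (i 0) (i 1) (i 2)) \<longleftrightarrow> (\<exists>i j l. P i j l)"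
    for P :: "nat \<Rightarrow> nat \<Rightarrow> nat \<Rightarrow> bool"
    by metis
  show ?thesis
    unfolding avoids_pattern_def contains
    by (subst triple[where P = "\<lambda>i j l. i < j \<and> j < l \<and> l < length p \<and>
        (p ! i < p ! j \<longleftrightarrow> x < y) \<and> (p ! i < p ! l \<longleftrightarrow> x < z) \<and> (p ! j < p ! l \<longleftrightarrow> y < z)"])
       (simp only: not_ex de_Morgan_conj imp_conv_disj not_not disj_assoc)
qed

text \<open>Cut \<open>xs\<close> at the first letter where \<open>P\<close> fails. The head of
  \<open>xs\<close> and that letter form the start of a forbidden triple, so \<open>P\<close> cannot
  hold again afterwards. Stating the blocks as filters lets them be computed separately, from their
  sets and their order.\<close>

lemma filter_append_filter_if_no_return:
  assumes "xs \<noteq> []" "P (hd xs)"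
    and no_return: "\<And>i j l. i < j \<Longrightarrow> j < l \<Longrightarrow> l < length xs \<Longrightarrow>
      P (xs ! i) \<Longrightarrow> \<not> P (xs ! j) \<Longrightarrow> \<not> P (xs ! l)"
  shows "xs = filter P xs @ filter (\<lambda>x. \<not> P x) xs"
proof -
  define us vs where "us = takeWhile P xs" and "vs = dropWhile P xs"
  have xs: "xs = us @ vs"
    by (simp add: us_def vs_def)
  have us: "\<forall>x\<in>set us. P x"
    by (auto simp: us_def dest: set_takeWhileD)
  have us_pos: "0 < length us"
    using assms(1,2) by (cases xs) (auto simp: us_def)
  have vs: "\<not> P (vs ! m)" if "m < length vs" for m
  proof -
    have first: "\<not> P (vs ! 0)"
      using that hd_dropWhile[of P xs, folded vs_def] by (cases vs) auto
    show ?thesis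
    proof (cases "m = 0")
      case False
      have "P (xs ! 0)"
        using us us_pos xs by (auto simp: nth_append)
      then show ?thesis
        using no_return[of 0 "length us" "length us + m"] first us_pos that False
        by (simp add: xs nth_append)
    qed (use first in simp)
  qed
  then have "\<forall>x\<in>set vs. \<not> P x"
    by (auto simp: in_set_conv_nth)
  with us show ?thesis
    by (simp add: xs)
qed

lemma sorted_wrt_filter_iff:
  "sorted_wrt R (filter P xs) \<longleftrightarrow> sorted_wrt (\<lambda>x y. P x \<longrightarrow> P y \<longrightarrow> R x y) xs"
  by (induction xs) auto

text \<open>A strictly increasing list is determined by its set, so a run is forced once its letters
  are known.\<close>

lemma strict_sorted_filter_eq_upt:
  assumes "\<And>i j. i < j \<Longrightarrow> j < length xs \<Longrightarrow> P (xs ! i) \<Longrightarrow> P (xs ! j) \<Longrightarrow> xs ! i < xs ! j"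
    and "{x \<in> set xs. P x} = {a..<b}"
  shows "filter P xs = [a..<b]"
proof (rule strict_sorted_equal)
  show "sorted_wrt (<) (filter P xs)"
    unfolding sorted_wrt_filter_iff unfolding sorted_wrt_iff_nth_less using assms(1) by simp
qed (use assms(2) in auto)

definition low_first :: "nat \<Rightarrow> nat \<Rightarrow> nat list" where
  "low_first n k = k # [1..<k] @ [Suc k..<Suc n]"

definition high_first :: "nat \<Rightarrow> nat \<Rightarrow> nat list" where
  "high_first n k = k # [Suc k..<Suc n] @ [1..<k]"

text \<open>Everything after the leading \<open>k\<close> increases, so a descent must start at
  \<open>k\<close> and cannot be the 32 of a 132. After rotation \<open>k\<close> is last, so every
  descent ends there and leaves no room for the 3 of a 213.\<close>

lemma low_first_mem:
  assumes "k \<in> {1..n}"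
  shows "low_first n k \<in> second_shift_avoiders n [1, 3, 2] [2, 1, 3]"
proof -
  have length: "length (low_first n k) = n"
    using assms by (auto simp: low_first_def simp del: upt_Suc)
  have nth: "low_first n k ! i = (if i = 0 then k else if i < k then i else Suc i)" if "i < n" for i
    using that assms by (auto simp: low_first_def nth_append nth_Cons' simp del: upt_Suc)
  have nth_rotate: "rotate1 (low_first n k) ! i =
      (if Suc i = n then k else if Suc i < k then Suc i else Suc (Suc i))" if "i < n" for i
    using that assms by (auto simp: low_first_def nth_append simp del: upt_Suc)
  have "low_first n k \<in> permutations_of_set {1..n}"
    using assms by (auto simp: permutations_of_set_def low_first_def simp del: upt_Suc)
  moreover have "avoids_pattern (low_first n k) [1, 3, 2]"
    by (auto simp: avoids_pattern_length_3 length nth)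
  moreover have "avoids_pattern (rotate1 (low_first n k)) [2, 1, 3]"
    by (auto simp: avoids_pattern_length_3 length nth_rotate)
  ultimately show ?thesis
    by (simp add: second_shift_avoiders_def)
qed

text \<open>This list and its rotation are cyclic shifts of the identity: two increasing blocks, the
  first entirely above the second. A descent runs from the first block to the second. A letter
  before it exceeds the whole second block, which excludes 132; a letter after it lies below the
  whole first block, which excludes 213.\<close>

lemma high_first_mem:
  assumes "k \<in> {1..n}"
  shows "high_first n k \<in> second_shift_avoiders n [1, 3, 2] [2, 1, 3]"
proof -
  have length: "length (high_first n k) = n"
    using assms by (auto simp: high_first_def simp del: upt_Suc)
  have nth: "high_first n k ! i = (if i + k \<le> n then i + k else i + k - n)" if "i < n" for i
    using that assms by (auto simp: high_first_def nth_append nth_Cons' simp del: upt_Suc)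
  have nth_rotate: "rotate1 (high_first n k) ! i =
      (if i + k < n then Suc (i + k) else Suc (i + k) - n)" if "i < n" for i
    using that assms by (auto simp: high_first_def nth_append simp del: upt_Suc)
  have "high_first n k \<in> permutations_of_set {1..n}"
    using assms by (auto simp: permutations_of_set_def high_first_def simp del: upt_Suc)
  moreover have "avoids_pattern (high_first n k) [1, 3, 2]"
    using assms by (auto simp: avoids_pattern_length_3 length nth)
  moreover have "avoids_pattern (rotate1 (high_first n k)) [2, 1, 3]"
    using assms by (auto simp: avoids_pattern_length_3 length nth_rotate)
  ultimately show ?thesis
    by (simp add: second_shift_avoiders_def)
qed

lemma second_shift_avoiders_132_213_cases:
  assumes "n \<ge> 1" "p \<in> second_shift_avoiders n [1, 3, 2] [2, 1, 3]"
  obtains k where "k \<in> {1..n}" "p = low_first n k \<or> p = high_first n k"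
proof -
  have p: "set p = {1..n}" "distinct p"
    and av132: "avoids_pattern p [1, 3, 2]" and av213: "avoids_pattern (rotate1 p) [2, 1, 3]"
    using assms by (auto simp: second_shift_avoiders_def permutations_of_set_def)
  from p(1) assms(1) obtain k q where pkq: "p = k # q"
    by (cases p) auto
  have k: "k \<in> {1..n}" and set_q: "set q = {1..n} - {k}"
    using p unfolding pkq by auto
  note av132 = av132[unfolded avoids_pattern_length_3 pkq, rule_format]
  note av213 = av213[unfolded avoids_pattern_length_3 pkq, rule_format]
  \<comment> \<open>In \<open>p\<close> the letter \<open>k\<close> at position 0 acts as the 1 of a
    132; in \<open>q @ [k]\<close> it sits at position \<open>length q\<close> and acts as the 3 of
    a 213.\<close>
  have high_inc: "q ! i < q ! j" if "i < j" "j < length q" "k < q ! i" "k < q ! j" for i j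
    using av132[of 0 "Suc i" "Suc j"] that by simp
  have low_inc: "q ! i < q ! j" if "i < j" "j < length q" "q ! i < k" "q ! j < k" for i j
    using av213[of i j "length q"] that by (simp add: nth_append)
  have dichotomy: "\<not> q ! i < k \<longleftrightarrow> k < q ! i" if "i < length q" for i
  proof -
    have "q ! i \<noteq> k"
      using nth_mem[OF that] set_q by auto
    then show ?thesis
      by auto
  qed
  \<comment> \<open>The two low letters increase by \<open>low_inc\<close>, so with the high letter
    between them they form a 132. Dually, high letters around a low one form a 213.\<close>
  have no_lhl: False
    if "i < j" "j < l" "l < length q" "q ! i < k" "\<not> q ! j < k" "q ! l < k" for i j l
    using av132[of "Suc i" "Suc j" "Suc l"] low_inc[of i l] that by simp
  have no_hlh: False
    if "i < j" "j < l" "l < length q" "\<not> q ! i < k" "q ! j < k" "\<not> q ! l < k" for i j l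
    using av213[of i j l] high_inc[of i l] dichotomy[of i] dichotomy[of l] that
    by (simp add: nth_append)
  have low: "filter (\<lambda>x. x < k) q = [1..<k]"
    by (rule strict_sorted_filter_eq_upt) (use low_inc set_q k in auto)
  have high: "filter (\<lambda>x. \<not> x < k) q = [Suc k..<Suc n]"
    by (rule strict_sorted_filter_eq_upt) (use high_inc dichotomy set_q k in auto)
  have "q = [1..<k] @ [Suc k..<Suc n] \<or> q = [Suc k..<Suc n] @ [1..<k]"
  proof (cases "q = []")
    case True
    then show ?thesis
      using low high by simp
  next
    case False
    show ?thesis
    proof (cases "hd q < k")
      case hd: True
      have "q = filter (\<lambda>x. x < k) q @ filter (\<lambda>x. \<not> x < k) q"
        by (rule filter_append_filter_if_no_return) (use False hd no_lhl in blast)+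
      then show ?thesis
        using low high by simp
    next
      case hd: False
      have "q = filter (\<lambda>x. \<not> x < k) q @ filter (\<lambda>x. \<not> \<not> x < k) q"
        by (rule filter_append_filter_if_no_return) (use False hd no_hlh in blast)+
      then show ?thesis
        using low high by simp
    qed
  qed
  then show thesis
    using that[OF k] by (auto simp: pkq low_first_def high_first_def)
qed

theorem proposition5p7:
  fixes n :: nat
  assumes "n \<ge> 2"
  shows "card (second_shift_avoiders n [1, 3, 2] [2, 1, 3]) = 2 * n - 2"
proof -
  \<comment> \<open>For these \<open>k\<close> one of the runs is empty, so the order of the runs is
    immaterial. Hence \<open>high_first\<close> is counted only over \<open>{2..<n}\<close>.\<close>
  have extremes: "high_first n 1 = low_first n 1" "high_first n n = low_first n n"
    by (simp_all add: low_first_def high_first_def)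
  have "second_shift_avoiders n [1, 3, 2] [2, 1, 3] = low_first n ` {1..n} \<union> high_first n ` {2..<n}"
    (is "?L = ?R")
  proof
    show "?L \<subseteq> ?R"
    proof
      fix p assume "p \<in> ?L"
      with assms obtain k where k: "k \<in> {1..n}" and p: "p = low_first n k \<or> p = high_first n k"
        using second_shift_avoiders_132_213_cases[of n p] by auto
      show "p \<in> ?R"
      proof (cases "k \<in> {2..<n}")
        case False
        with k have "k = 1 \<or> k = n"
          by auto
        with k p extremes show ?thesis
          by auto
      qed (use k p in auto)
    qed
    show "?R \<subseteq> ?L"
      using low_first_mem high_first_mem by auto
  qed
  moreover have "low_first n ` {1..n} \<inter> high_first n ` {2..<n} = {}"
  proof -
    have "low_first n k \<noteq> high_first n k" if "k \<in> {2..<n}" for k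
    proof -
      \<comment> \<open>Both runs are nonempty here, so the second letters are 1 and
        \<open>Suc k\<close>.\<close>
      have "low_first n k ! 1 \<noteq> high_first n k ! 1"
        using that by (auto simp: low_first_def high_first_def nth_append simp del: upt_Suc)
      then show ?thesis
        by metis
    qed
    \<comment> \<open>The first letter recovers \<open>k\<close>; injectivity of both families below
      has the same reason.\<close>
    moreover have "k = k'" if "low_first n k = high_first n k'" for k k'
      using that by (simp add: low_first_def high_first_def)
    ultimately show ?thesis
      by blast
  qed
  moreover have "inj_on (low_first n) {1..n}" "inj_on (high_first n) {2..<n}"
    by (auto simp: inj_on_def low_first_def high_first_def)
  ultimately have "card (second_shift_avoiders n [1, 3, 2] [2, 1, 3]) = card {1..n} + card {2..<n}"
    by (simp add: card_Un_disjoint card_image)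
  with assms show ?thesis
    by simp
qed

end
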